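(* Let $h\ge 1$ be an integer and let $q=2^h$ (so $q\ge 2$). Then $$\sigma_2(Q_{2q-3})=\sigma_2(Q_{2q-2})=q,\qquad \sigma_2(Q_{2q-1})=\sigma_2(Q_{2q})=q+1 .$$
   Context: For a graph $G$ and a vertex $x$, $N(x)$ is the open neighbourhood and $N[x]=N(x)\cup\{x\}$ the closed neighbourhood. $[q]=\{1,\dots,q\}$. Let $I\subseteq V(G)$ be an independent set and $k\ge 0$. An attack is a set $S\subseteq I$ with $|S|\le k$. A surjective proper colouring $c:V(G)\to[q]$ (adjacent vertices get different colours), with colour classes $C_i=c^{-1}(i)$, is an $(I,k,q)$-defensive silver colouring if for every colour $i\in[q]$ and every attack $S\subseteq I$ there is an injective map $f_{i,S}:S\to C_i$ with $f_{i,S}(x)\in N[x]$ for every $x\in S$. $\sigma_k(G,I)$ denotes the largest $q$ for which $G$ has an $(I,k,q)$-defensive silver colouring. The hypercube $Q_d$ is the graph on $\mathbb F_2^d$ in which two vertices are adjacent when they differ in exactly one coordinate. Its parity classes are the set of vectors of even Hamming weight and the set of vectors of odd Hamming weight. $\sigma_k(Q_d)$ denotes $\sigma_k(Q_d,I)$ where $I$ is a parity class (both choices give the same value). *)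

theory Defs
  imports
    "Graph_Theory.Pair_Digraph"
    "Jordan_Normal_Form.Matrix"
    "HOL-Library.Z2"
begin

text \<open>
  A (finite simple undirected) graph is a \<open>pair_graph\<close>: a finite digraph without loops whose arc
  relation is symmetric. \<open>x\<close> and \<open>y\<close> are adjacent iff \<open>(x, y)\<close> is an arc.
\<close>

definition open_nbhd :: "'a pair_pre_digraph \<Rightarrow> 'a \<Rightarrow> 'a set" where
  "open_nbhd G x = {y. (x, y) \<in> parcs G}"

definition closed_nbhd :: "'a pair_pre_digraph \<Rightarrow> 'a \<Rightarrow> 'a set" where
  "closed_nbhd G x = insert x (open_nbhd G x)"

definition independent_set :: "'a pair_pre_digraph \<Rightarrow> 'a set \<Rightarrow> bool" where
  "independent_set G I \<longleftrightarrow> I \<subseteq> pverts G \<and> (\<forall>x\<in>I. \<forall>y\<in>I. (x, y) \<notin> parcs G)"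

definition proper_colouring :: "'a pair_pre_digraph \<Rightarrow> ('a \<Rightarrow> nat) \<Rightarrow> bool" where
  "proper_colouring G c \<longleftrightarrow> (\<forall>x y. (x, y) \<in> parcs G \<longrightarrow> c x \<noteq> c y)"

definition colour_class :: "'a pair_pre_digraph \<Rightarrow> ('a \<Rightarrow> nat) \<Rightarrow> nat \<Rightarrow> 'a set" where
  "colour_class G c i = {v \<in> pverts G. c v = i}"

definition attack :: "'a set \<Rightarrow> nat \<Rightarrow> 'a set \<Rightarrow> bool" where
  "attack I k S \<longleftrightarrow> S \<subseteq> I \<and> finite S \<and> card S \<le> k"

text \<open>
  The next two notions are meant for a \<open>pair_graph\<close> \<open>G\<close> and an \<open>I\<close> with \<open>independent_set G I\<close>;
  for hypercubes and their parity classes this is established below.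
\<close>

definition defensive_silver_colouring ::
    "'a pair_pre_digraph \<Rightarrow> 'a set \<Rightarrow> nat \<Rightarrow> nat \<Rightarrow> ('a \<Rightarrow> nat) \<Rightarrow> bool" where
  "defensive_silver_colouring G I k q c \<longleftrightarrow>
     c ` pverts G = {1..q} \<and> proper_colouring G c \<and>
     (\<forall>i\<in>{1..q}. \<forall>S. attack I k S \<longrightarrow>
        (\<exists>f. inj_on f S \<and> f ` S \<subseteq> colour_class G c i \<and> (\<forall>x\<in>S. f x \<in> closed_nbhd G x)))"

text \<open>
  \<open>Max\<close> is the maximum of a finite set of numbers by lemma \<open>finite_silver_numbers\<close>; as usual it is
  unspecified if no such colouring exists.
\<close>

definition sigma :: "nat \<Rightarrow> 'a pair_pre_digraph \<Rightarrow> 'a set \<Rightarrow> nat" where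
  "sigma k G I = Max {q. \<exists>c. defensive_silver_colouring G I k q c}"

lemma finite_silver_numbers:
  assumes "finite (pverts G)"
  shows "finite {q. \<exists>c. defensive_silver_colouring G I k q c}"
proof (rule finite_subset)
  show "{q. \<exists>c. defensive_silver_colouring G I k q c} \<subseteq> {..card (pverts G)}"
  proof clarify
    fix q c assume "defensive_silver_colouring G I k q c"
    then have "card {1..q} \<le> card (pverts G)"
      unfolding defensive_silver_colouring_def using card_image_le[OF assms, of c] by simp
    then show "q \<le> card (pverts G)" by simp
  qed
qed simp

text \<open>
  \<open>\<bbbF>\<^sub>2\<^sup>d\<close> is \<open>carrier_vec d\<close> over the two-element field \<open>bit\<close>; coordinates are indexed by \<open>0..<d\<close>.
\<close>

definition hypercube :: "nat \<Rightarrow> bit vec pair_pre_digraph" where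
  "hypercube d = \<lparr> pverts = carrier_vec d,
     parcs = {(x, y). x \<in> carrier_vec d \<and> y \<in> carrier_vec d \<and> card {i. i < d \<and> x $ i \<noteq> y $ i} = 1} \<rparr>"

definition hamming_weight :: "bit vec \<Rightarrow> nat" where
  "hamming_weight x = card {i. i < dim_vec x \<and> x $ i \<noteq> 0}"

definition parity_classes :: "nat \<Rightarrow> bit vec set set" where
  "parity_classes d =
     {{x \<in> carrier_vec d. even (hamming_weight x)}, {x \<in> carrier_vec d. odd (hamming_weight x)}}"

lemma finite_carrier_vec_bit: "finite (carrier_vec d :: bit vec set)"
proof -
  have fin: "finite (UNIV :: bit set)"
  proof -
    have "(UNIV :: bit set) = {0, 1}" using bit.exhaust by blast
    then show ?thesis by (metis finite.emptyI finite.insertI)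
  qed
  have "(carrier_vec d :: bit vec set) \<subseteq> vec d ` ({..<d} \<rightarrow>\<^sub>E UNIV)"
  proof
    fix x :: "bit vec" assume x: "x \<in> carrier_vec d"
    show "x \<in> vec d ` ({..<d} \<rightarrow>\<^sub>E UNIV)"
    proof (rule image_eqI)
      show "x = vec d (restrict (\<lambda>i. x $ i) {..<d})" using x by (intro eq_vecI) auto
    qed (simp add: restrict_PiE_iff)
  qed
  moreover have "finite ({..<d} \<rightarrow>\<^sub>E (UNIV :: bit set))" using fin by (intro finite_PiE) auto
  ultimately show ?thesis by (rule finite_subset[OF _ finite_imageI])
qed

lemma pair_graph_hypercube: "pair_graph (hypercube d)"
proof
  show "finite (pverts (hypercube d))"
    by (simp add: hypercube_def finite_carrier_vec_bit)
  show "finite (parcs (hypercube d))"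
    by (rule finite_subset[of _ "carrier_vec d \<times> carrier_vec d"])
      (auto simp: hypercube_def finite_carrier_vec_bit)
  show "symmetric (with_proj (hypercube d))"
    unfolding symmetric_def with_proj_simps
  proof (rule symI)
    fix x y assume "(x, y) \<in> parcs (hypercube d)"
    moreover have "{i. i < d \<and> x $ i \<noteq> y $ i} = {i. i < d \<and> y $ i \<noteq> x $ i}"
      by (intro Collect_cong conj_cong refl) (rule neq_commute)
    ultimately show "(y, x) \<in> parcs (hypercube d)" by (simp add: hypercube_def del: bit_not_zero_iff)
  qed
qed (auto simp: hypercube_def)

lemma parity_change_hypercube:
  assumes "(x, y) \<in> parcs (hypercube d)"
  shows "even (hamming_weight x) \<longleftrightarrow> odd (hamming_weight y)"
proof -
  let ?A = "{i. i < d \<and> x $ i \<noteq> 0}" and ?B = "{i. i < d \<and> y $ i \<noteq> 0}"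
  from assms have dims: "dim_vec x = d" "dim_vec y = d"
    and "card {i. i < d \<and> x $ i \<noteq> y $ i} = 1"
    by (auto simp: hypercube_def)
  then obtain j where j: "{i. i < d \<and> x $ i \<noteq> y $ i} = {j}" by (auto simp: card_1_singleton_iff)
  then have jd: "j < d" and xy: "x $ j \<noteq> y $ j" by auto
  have same: "x $ i = y $ i" if "i < d" "i \<noteq> j" for i using j that by blast
  have AB: "?A - {j} = ?B - {j}" using same by auto
  have ex: "card ?A = (if x $ j = 0 then 0 else 1) + card (?A - {j})"
  proof (cases "x $ j = 0")
    case True
    then have "?A - {j} = ?A" by auto
    then show ?thesis using True by simp
  next
    case False
    then have "j \<in> ?A" using jd by simp
    then show ?thesis using False card_Suc_Diff1[of ?A j] by (simp del: bit_not_zero_iff)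
  qed
  have ey: "card ?B = (if y $ j = 0 then 0 else 1) + card (?B - {j})"
  proof (cases "y $ j = 0")
    case True
    then have "?B - {j} = ?B" by auto
    then show ?thesis using True by simp
  next
    case False
    then have "j \<in> ?B" using jd by simp
    then show ?thesis using False card_Suc_Diff1[of ?B j] by (simp del: bit_not_zero_iff)
  qed
  from xy have "(x $ j = 0 \<and> y $ j = 1) \<or> (x $ j = 1 \<and> y $ j = 0)"
    by (cases "x $ j"; cases "y $ j") simp_all
  then have "card ?B = Suc (card ?A) \<or> card ?A = Suc (card ?B)"
    using ex ey unfolding AB by fastforce
  then show ?thesis
    unfolding hamming_weight_def dims by (elim disjE) (simp_all only: even_Suc not_not)
qed

lemma independent_parity_class:
  assumes "I \<in> parity_classes d"
  shows "independent_set (hypercube d) I"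
  using assms parity_change_hypercube[of _ _ d]
  by (auto simp: parity_classes_def independent_set_def hypercube_def)

end

theory Submission
  imports Defs
begin

text \<open>
  For attacks of size at most two, Hall's condition says the following about a proper colouring with \<open>r\<close>
  colours. Every \<open>x \<in> I\<close> sees each colour other than its own on a neighbour, and no vertex \<open>z\<close> is,
  for two different neighbours in \<open>I\<close>, the only neighbour with the colour of \<open>z\<close>. Call \<open>z\<close> a
  private neighbour of \<open>x\<close> if it is the only neighbour of \<open>x\<close> with its colour.

  Upper bound: \<open>x \<in> I\<close> has \<open>d\<close> neighbours and they show at least \<open>r - 1\<close> colours, so \<open>x\<close> has at
  least \<open>2 (r - 1) - d\<close> private neighbours. A vertex outside \<open>I\<close> is private for at most one \<open>x\<close>,
  and the two parity classes are equally large, so \<open>2 (r - 1) - d \<le> 1\<close>, that is \<open>2 r \<le> d + 3\<close>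
  (lemma \<open>silver_upper_bound\<close>).

  Lower bound: label the coordinate directions by subsets of \<open>{..<h}\<close>, that is, by vectors of
  \<open>\<bbbF>\<^sub>2\<^sup>h\<close>, and let the syndrome of a vertex be the sum of the labels of its nonzero coordinates. A
  step in direction \<open>i\<close> adds the label of \<open>i\<close> to the syndrome. When every label is used twice,
  except that one may be used only once, the private neighbours of all \<open>x \<in> I\<close> lie in a single
  direction, so that no vertex is private for two others (lemma \<open>silver_criterion\<close>). With \<open>m\<close>
  labels such a labelling exists in dimensions \<open>2 m - 1\<close> and \<open>2 m\<close>. Using the \<open>q - 1\<close> nonzero
  labels, the syndrome is itself a proper colouring with \<open>q\<close> colours in dimensions \<open>2 q - 3\<close> and
  \<open>2 q - 2\<close>. Using all \<open>q\<close> labels, every vertex sees all \<open>q\<close> syndromes; then one colours the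
  vertices outside \<open>I\<close> by their syndromes and gives all of \<open>I\<close> one additional colour, which yields
  \<open>q + 1\<close> colours in dimensions \<open>2 q - 1\<close> and \<open>2 q\<close>.
\<close>

section \<open>Neighbourhoods and parity in the hypercube\<close>

definition flip :: "nat \<Rightarrow> bit vec \<Rightarrow> bit vec" where
  "flip i x = vec (dim_vec x) (\<lambda>k. x $ k + of_bool (k = i))"

lemma flip_carrier [simp]: "x \<in> carrier_vec d \<Longrightarrow> flip i x \<in> carrier_vec d"
  by (auto simp: flip_def)

lemma flip_index: "x \<in> carrier_vec d \<Longrightarrow> k < d \<Longrightarrow> flip i x $ k = x $ k + of_bool (k = i)"
  by (auto simp: flip_def)

lemma flip_index_eq_iff:
  assumes "x \<in> carrier_vec d" "k < d"
  shows "flip i x $ k = x $ k \<longleftrightarrow> k \<noteq> i"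
  using assms by (cases "x $ k"; cases "k = i") (simp_all add: flip_index)

lemma flip_flip: "flip i (flip i x) = x"
  by (rule eq_vecI) (auto simp: flip_def add.assoc)

lemma flip_eq_iff: "flip i x = flip i y \<longleftrightarrow> x = y"
  by (metis flip_flip)

lemma flip_inj_index:
  assumes "x \<in> carrier_vec d" "i < d" "flip i x = flip j x"
  shows "i = j"
  using assms flip_index_eq_iff by metis

lemma parcs_hypercube_iff:
  "(x, y) \<in> parcs (hypercube d) \<longleftrightarrow> x \<in> carrier_vec d \<and> (\<exists>i<d. y = flip i x)"
proof
  assume "(x, y) \<in> parcs (hypercube d)"
  then have x: "x \<in> carrier_vec d" and y: "y \<in> carrier_vec d"
    and "card {i. i < d \<and> x $ i \<noteq> y $ i} = 1"
    by (auto simp: hypercube_def)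
  then obtain j where j: "{i. i < d \<and> x $ i \<noteq> y $ i} = {j}"
    by (auto simp: card_1_singleton_iff)
  have "y = flip j x"
  proof (rule eq_vecI)
    fix k assume "k < dim_vec (flip j x)"
    then have k: "k < d" using x by (auto simp: flip_def)
    have "x $ k \<noteq> y $ k \<longleftrightarrow> k = j" using j k by blast
    then show "y $ k = flip j x $ k"
      using k x by (cases "x $ k"; cases "y $ k"; cases "k = j") (simp_all add: flip_index)
  qed (use x y in \<open>auto simp: flip_def\<close>)
  with x j show "x \<in> carrier_vec d \<and> (\<exists>i<d. y = flip i x)" by blast
next
  assume "x \<in> carrier_vec d \<and> (\<exists>i<d. y = flip i x)"
  then obtain i where x: "x \<in> carrier_vec d" and i: "i < d" and y: "y = flip i x" by blast
  have "x $ k \<noteq> y $ k \<longleftrightarrow> k = i" if "k < d" for k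
    using flip_index_eq_iff[OF x that, of i] y by metis
  then have "{k. k < d \<and> x $ k \<noteq> y $ k} = {i}" using i by blast
  then show "(x, y) \<in> parcs (hypercube d)" using x y by (simp add: hypercube_def)
qed

lemma pverts_hypercube [simp]: "pverts (hypercube d) = carrier_vec d"
  by (simp add: hypercube_def)

lemma open_nbhd_hypercube:
  "x \<in> carrier_vec d \<Longrightarrow> open_nbhd (hypercube d) x = (\<lambda>i. flip i x) ` {..<d}"
  by (auto simp: open_nbhd_def parcs_hypercube_iff)

lemma parity_class_carrier: "I \<in> parity_classes d \<Longrightarrow> x \<in> I \<Longrightarrow> x \<in> carrier_vec d"
  by (auto simp: parity_classes_def)

lemma parity_class_flip:
  assumes "I \<in> parity_classes d" "x \<in> carrier_vec d" "i < d"
  shows "flip i x \<in> I \<longleftrightarrow> x \<notin> I"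
proof -
  have "even (hamming_weight x) \<longleftrightarrow> odd (hamming_weight (flip i x))"
    by (rule parity_change_hypercube[of _ _ d]) (use assms in \<open>auto simp: parcs_hypercube_iff\<close>)
  then show ?thesis using assms by (auto simp: parity_classes_def)
qed

lemma parity_class_nonempty:
  assumes "I \<in> parity_classes d" "d \<ge> 1"
  shows "I \<noteq> {}"
  using parity_class_flip[OF assms(1) zero_carrier_vec, of 0] assms(2) by auto

section \<open>Upper bound by counting private neighbours\<close>

definition private_nbrs :: "'a pair_pre_digraph \<Rightarrow> ('a \<Rightarrow> nat) \<Rightarrow> 'a \<Rightarrow> 'a set" where
  "private_nbrs G c x = {z \<in> open_nbhd G x. \<forall>w\<in>open_nbhd G x. c w = c z \<longrightarrow> w = z}"

text \<open>
  A fibre of \<open>c\<close> with one element counts twice on the right, and every other fibre has at least two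
  elements.
\<close>

lemma twice_card_image_le:
  assumes "finite N"
  shows "2 * card (c ` N) \<le> card N + card {z \<in> N. \<forall>w\<in>N. c w = c z \<longrightarrow> w = z}"
    (is "_ \<le> _ + card ?U")
proof -
  have fib: "2 \<le> card {z \<in> N. c z = j} + card {z \<in> ?U. c z = j}" if "j \<in> c ` N" for j
  proof -
    from that obtain z where z: "z \<in> N" "c z = j" by blast
    show ?thesis
    proof (cases "z \<in> ?U")
      case True
      then have "0 < card {z \<in> ?U. c z = j}" using z assms by (auto simp: card_gt_0_iff)
      moreover have "0 < card {z \<in> N. c z = j}" using z assms by (auto simp: card_gt_0_iff)
      ultimately show ?thesis by linarith
    next
      case False
      then obtain w where w: "w \<in> N" "c w = j" "w \<noteq> z" using z by auto
      have "card {z, w} \<le> card {z \<in> N. c z = j}"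
        by (rule card_mono) (use z w assms in auto)
      then show ?thesis using w by simp
    qed
  qed
  have "2 * card (c ` N) \<le> (\<Sum>j\<in>c ` N. card {z \<in> N. c z = j} + card {z \<in> ?U. c z = j})"
    using sum_mono[of "c ` N" "\<lambda>_. 2::nat", OF fib] by (simp add: mult.commute)
  also have "\<dots> = (\<Sum>j\<in>c ` N. card {z \<in> N. c z = j}) + (\<Sum>j\<in>c ` N. card {z \<in> ?U. c z = j})"
    by (rule sum.distrib)
  also have "(\<Sum>j\<in>c ` N. card {z \<in> N. c z = j}) = card N"
    using sum.group[of N "c ` N" c "\<lambda>_. 1::nat"] assms by simp
  also have "(\<Sum>j\<in>c ` N. card {z \<in> ?U. c z = j}) = card ?U"
    using sum.group[of ?U "c ` N" c "\<lambda>_. 1::nat"] assms by auto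
  finally show ?thesis .
qed

lemma silver_sees_colour:
  assumes "defensive_silver_colouring G I k r c" "k \<ge> 1" "x \<in> I" "j \<in> {1..r}" "j \<noteq> c x"
  shows "j \<in> c ` open_nbhd G x"
proof -
  have "attack I k {x}" using assms by (auto simp: attack_def)
  then obtain f where "f x \<in> colour_class G c j" "f x \<in> closed_nbhd G x"
    using assms(1,4) unfolding defensive_silver_colouring_def by (metis image_subset_iff insertI1)
  then show ?thesis using assms(5) by (auto simp: colour_class_def closed_nbhd_def)
qed

text \<open>
  If \<open>z\<close> were private for both \<open>x\<close> and \<open>y\<close>, then against the attack \<open>{x, y}\<close> both would have to be
  defended by \<open>z\<close> in the colour of \<open>z\<close>: as the colouring is proper, neither \<open>x\<close> nor \<open>y\<close> has that
  colour.
\<close>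

lemma silver_private_unique:
  assumes silver: "defensive_silver_colouring G I k r c" and "k \<ge> 2"
    and x: "x \<in> I" "z \<in> private_nbrs G c x" and y: "y \<in> I" "z \<in> private_nbrs G c y"
    and z: "z \<in> pverts G"
  shows "x = y"
proof (rule ccontr)
  assume "x \<noteq> y"
  then have "attack I k {x, y}" using assms by (auto simp: attack_def)
  moreover have "c z \<in> {1..r}" using silver z by (auto simp: defensive_silver_colouring_def)
  ultimately obtain f where f: "inj_on f {x, y}" "f ` {x, y} \<subseteq> colour_class G c (c z)"
      "\<forall>u\<in>{x, y}. f u \<in> closed_nbhd G u"
    using silver unfolding defensive_silver_colouring_def by meson
  have "f u = z" if "u \<in> {x, y}" for u
  proof -
    have zu: "z \<in> private_nbrs G c u" using that x y by auto
    then have "c u \<noteq> c z" using silver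
      by (auto simp: private_nbrs_def open_nbhd_def defensive_silver_colouring_def
          proper_colouring_def)
    then show ?thesis using zu f(2,3) that
      by (auto simp: private_nbrs_def closed_nbhd_def colour_class_def)
  qed
  then show False using f(1) \<open>x \<noteq> y\<close> by (auto simp: inj_on_def)
qed

lemma silver_upper_bound:
  assumes I: "I \<in> parity_classes d" and d: "d \<ge> 1"
    and silver: "defensive_silver_colouring (hypercube d) I 2 r c"
  shows "2 * r \<le> d + 3"
proof (rule ccontr)
  let ?V = "carrier_vec d :: bit vec set" and ?N = "open_nbhd (hypercube d)"
    and ?U = "private_nbrs (hypercube d) c"
  assume contr: "\<not> 2 * r \<le> d + 3"
  have finV: "finite ?V" by (rule finite_carrier_vec_bit)
  have IV: "I \<subseteq> ?V" using parity_class_carrier[OF I] by blast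
  then have finI: "finite I" using finV finite_subset by blast
  have U_out: "?U x \<subseteq> ?V - I" if "x \<in> I" for x
  proof -
    have "x \<in> ?V" using that IV by blast
    then show ?thesis
      using that by (auto simp: private_nbrs_def open_nbhd_hypercube parity_class_flip[OF I])
  qed
  have U2: "2 \<le> card (?U x)" if x: "x \<in> I" for x
  proof -
    have N: "?N x = (\<lambda>i. flip i x) ` {..<d}" using x IV by (intro open_nbhd_hypercube) blast
    then have fin: "finite (?N x)" and "card (?N x) \<le> d"
      using card_image_le[of "{..<d}" "\<lambda>i. flip i x"] by auto
    have "{1..r} - {c x} \<subseteq> c ` ?N x" using silver_sees_colour[OF silver _ x] by force
    then have "card ({1..r} - {c x}) \<le> card (c ` ?N x)" using fin by (intro card_mono) auto
    moreover have "card ({1..r} - {c x}) \<ge> r - 1"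
      using diff_card_le_card_Diff[of "{c x}" "{1..r}"] by simp
    moreover have "2 * card (c ` ?N x) \<le> card (?N x) + card (?U x)"
      unfolding private_nbrs_def by (rule twice_card_image_le[OF fin])
    ultimately show ?thesis using \<open>card (?N x) \<le> d\<close> contr by linarith
  qed
  have "2 * card I \<le> (\<Sum>x\<in>I. card (?U x))"
    using sum_mono[of I "\<lambda>_. 2::nat", OF U2] by (simp add: mult.commute)
  also have "\<dots> = card (\<Union>x\<in>I. ?U x)"
  proof (rule card_UN_disjoint[symmetric])
    show "\<forall>x\<in>I. finite (?U x)" using U_out finV by (meson finite_Diff finite_subset)
    show "\<forall>x\<in>I. \<forall>y\<in>I. x \<noteq> y \<longrightarrow> ?U x \<inter> ?U y = {}"
      using silver_private_unique[OF silver] U_out by fastforce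
  qed (rule finI)
  also have "\<dots> \<le> card (?V - I)" using U_out finV by (intro card_mono) auto
  also have "\<dots> \<le> card I"
  proof (rule card_inj_on_le[OF _ _ finI])
    show "inj_on (flip 0) (?V - I)" by (simp add: inj_on_def flip_eq_iff)
    show "flip 0 ` (?V - I) \<subseteq> I" using d by (auto simp: parity_class_flip[OF I])
  qed
  finally show False using finI parity_class_nonempty[OF I d] by simp
qed

section \<open>Colourings whose private neighbours lie in one direction\<close>

text \<open>
  An attacked vertex of the required colour defends itself and is out of reach of the other one. If
  neither has that colour, they compete only for a common neighbour, which they reach in different
  directions. One of these differs from \<open>p\<close>, and the vertex that uses it has another neighbour of
  the same colour.
\<close>

lemma silver_criterion:
  assumes I: "I \<in> parity_classes d" and d: "d \<ge> 1"
    and range: "c ` carrier_vec d \<subseteq> {1..r}"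
    and proper: "\<And>x i. x \<in> carrier_vec d \<Longrightarrow> i < d \<Longrightarrow> c (flip i x) \<noteq> c x"
    and sees: "\<And>x j. x \<in> I \<Longrightarrow> j \<in> {1..r} \<Longrightarrow> j \<noteq> c x \<Longrightarrow> \<exists>i<d. c (flip i x) = j"
    and twin: "\<And>x i. x \<in> I \<Longrightarrow> i < d \<Longrightarrow> i \<noteq> p \<Longrightarrow> \<exists>i'<d. i' \<noteq> i \<and> c (flip i' x) = c (flip i x)"
  shows "defensive_silver_colouring (hypercube d) I 2 r c"
  unfolding defensive_silver_colouring_def
proof (intro conjI ballI allI impI)
  let ?G = "hypercube d"
  have IV: "x \<in> carrier_vec d" if "x \<in> I" for x using parity_class_carrier[OF I that] .
  obtain x0 where x0: "x0 \<in> I" using parity_class_nonempty[OF I d] by blast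
  have "j \<in> c ` carrier_vec d" if "j \<in> {1..r}" for j
  proof (cases "j = c x0")
    case False
    then show ?thesis using sees[OF x0 that] IV[OF x0] flip_carrier by blast
  qed (use IV[OF x0] in blast)
  then show "c ` pverts ?G = {1..r}" using range by auto
  show "proper_colouring ?G c"
    unfolding proper_colouring_def parcs_hypercube_iff using proper by metis
  fix j S assume j: "j \<in> {1..r}" and S: "attack I 2 S"
  define D where "D x = closed_nbhd ?G x \<inter> colour_class ?G c j" for x
  have D_self: "x \<in> D x" if "x \<in> I" "c x = j" for x
    using that IV by (auto simp: D_def closed_nbhd_def colour_class_def)
  have D_flip: "flip i x \<in> D x" if "x \<in> I" "i < d" "c (flip i x) = j" for x i
    using that IV by (auto simp: D_def closed_nbhd_def colour_class_def open_nbhd_hypercube)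
  have D_ne: "\<exists>u. u \<in> D x" if "x \<in> I" for x
    using D_self[OF that] sees[OF that j] D_flip[OF that] by metis
  have I_D: "x \<notin> D y" if "x \<in> I" "y \<in> I" "x \<noteq> y" for x y
    using that IV parity_class_flip[OF I]
    by (auto simp: D_def closed_nbhd_def open_nbhd_hypercube)
  have D_two: "\<exists>u\<in>D x. \<exists>v\<in>D y. u \<noteq> v" if x: "x \<in> I" and y: "y \<in> I" and ne: "x \<noteq> y" for x y
  proof -
    consider "c x = j" | "c y = j" | "c x \<noteq> j" "c y \<noteq> j" by blast
    then show ?thesis
    proof cases
      case 1
      then show ?thesis using D_self[OF x] D_ne[OF y] I_D[OF x y ne] by metis
    next
      case 2
      then show ?thesis using D_self[OF y] D_ne[OF x] I_D[OF y x] ne by metis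
    next
      case 3
      obtain a where a: "a < d" "c (flip a x) = j" using sees[OF x j] 3 by blast
      obtain b where b: "b < d" "c (flip b y) = j" using sees[OF y j] 3 by blast
      show ?thesis
      proof (cases "flip a x = flip b y")
        case False
        then show ?thesis using D_flip[OF x a] D_flip[OF y b] by blast
      next
        case True
        then have "a \<noteq> b" using ne flip_eq_iff by metis
        then consider "a \<noteq> p" | "b \<noteq> p" by blast
        then show ?thesis
        proof cases
          case 1
          then obtain a' where a': "a' < d" "a' \<noteq> a" "c (flip a' x) = j"
            using twin[OF x a(1)] a(2) by metis
          then have "flip a' x \<noteq> flip b y" using flip_inj_index[OF IV[OF x] a'(1)] True by metis
          then show ?thesis using D_flip[OF x a'(1,3)] D_flip[OF y b] by blast
        next
          case 2
          then obtain b' where b': "b' < d" "b' \<noteq> b" "c (flip b' y) = j"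
            using twin[OF y b(1)] b(2) by metis
          then have "flip a x \<noteq> flip b' y" using flip_inj_index[OF IV[OF y] b'(1)] True by metis
          then show ?thesis using D_flip[OF x a] D_flip[OF y b'(1,3)] by blast
        qed
      qed
    qed
  qed
  have "\<exists>f. inj_on f S \<and> (\<forall>x\<in>S. f x \<in> D x)"
  proof -
    have "S \<subseteq> I" "finite S" "card S \<le> 2" using S by (auto simp: attack_def)
    then consider "S = {}" | x where "S = {x}" | x y where "S = {x, y}" "x \<noteq> y"
      by (metis One_nat_def card_0_eq card_1_singletonE card_2_iff le_Suc_eq le_zero_eq
          numeral_2_eq_2)
    then show ?thesis
    proof cases
      case 2
      then obtain u where "u \<in> D x" using D_ne \<open>S \<subseteq> I\<close> by blast
      then show ?thesis using 2 by (intro exI[of _ "\<lambda>_. u"]) auto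
    next
      case 3
      then obtain u v where "u \<in> D x" "v \<in> D y" "u \<noteq> v" using D_two \<open>S \<subseteq> I\<close> by blast
      then show ?thesis using 3 by (intro exI[of _ "\<lambda>w. if w = x then u else v"]) auto
    qed simp
  qed
  then show "\<exists>f. inj_on f S \<and> f ` S \<subseteq> colour_class ?G c j \<and> (\<forall>x\<in>S. f x \<in> closed_nbhd ?G x)"
    by (auto simp: D_def)
qed

section \<open>Syndrome colourings\<close>

text \<open>
  A vector of \<open>\<bbbF>\<^sub>2\<^sup>h\<close> is represented by its support, a subset of \<open>{..<h}\<close>; addition is then symmetric
  difference.
\<close>

definition syndrome :: "nat \<Rightarrow> nat \<Rightarrow> (nat \<Rightarrow> nat set) \<Rightarrow> bit vec \<Rightarrow> nat set" where
  "syndrome h d b x = {k. k < h \<and> (\<Sum>i<d. x $ i * of_bool (k \<in> b i)) = 1}"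

lemma syndrome_in_Pow: "syndrome h d b x \<in> Pow {..<h}"
  by (auto simp: syndrome_def)

lemma syndrome_flip:
  assumes x: "x \<in> carrier_vec d" and i: "i < d" and b: "b i \<in> Pow {..<h}"
  shows "syndrome h d b (flip i x) = sym_diff (syndrome h d b x) (b i)"
proof -
  define T where "T k = (\<Sum>l<d. x $ l * of_bool (k \<in> b l))" for k
  have "(\<Sum>l<d. flip i x $ l * of_bool (k \<in> b l)) = T k + of_bool (k \<in> b i)" for k
  proof -
    have "(\<Sum>l<d. flip i x $ l * of_bool (k \<in> b l))
        = (\<Sum>l<d. x $ l * of_bool (k \<in> b l) + (if l = i then of_bool (k \<in> b i) else 0))"
    proof (intro sum.cong refl)
      fix l assume "l \<in> {..<d}"
      then have "flip i x $ l = x $ l + of_bool (l = i)" using x by (simp only: lessThan_iff flip_index)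
      then show "flip i x $ l * of_bool (k \<in> b l)
          = x $ l * of_bool (k \<in> b l) + (if l = i then of_bool (k \<in> b i) else 0)"
        by (cases "l = i") (simp_all only: distrib_right of_bool_eq simp_thms if_True if_False
            mult_1 add_0_right mult_zero_left)
    qed
    then show ?thesis using i unfolding T_def by (simp only: sum.distrib) (simp add: sum.delta)
  qed
  moreover have "T k + of_bool (k \<in> b i) = 1 \<longleftrightarrow> (T k = 1) \<noteq> (k \<in> b i)" for k
    by (cases "T k") simp_all
  ultimately have "k \<in> syndrome h d b (flip i x) \<longleftrightarrow> k < h \<and> (T k = 1) \<noteq> (k \<in> b i)" for k
    by (simp only: syndrome_def mem_Collect_eq)
  moreover have "k \<in> syndrome h d b x \<longleftrightarrow> k < h \<and> T k = 1" for k
    by (simp only: syndrome_def mem_Collect_eq T_def)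
  ultimately show ?thesis using b by blast
qed

text \<open>
  Labels are dealt out cyclically. In dimension \<open>2 m - 1\<close> the second round stops one short, so that
  direction \<open>m - 1\<close> is the only one whose label is not repeated.
\<close>

lemma ex_labelling:
  assumes "finite L" "card L = m" "m \<ge> 1" "d = 2 * m - 1 \<or> d = 2 * m"
  obtains b :: "nat \<Rightarrow> 'a" and p where "b ` {..<d} = L"
    "\<And>i. i < d \<Longrightarrow> i \<noteq> p \<Longrightarrow> \<exists>i'<d. i' \<noteq> i \<and> b i' = b i"
proof -
  obtain g where g: "bij_betw g {0..<m} L"
    using ex_bij_betw_nat_finite[OF assms(1)] assms(2) by blast
  define b where "b i = g (i mod m)" for i
  have "b ` {..<d} = L"
  proof
    show "b ` {..<d} \<subseteq> L" using g assms(3) by (auto simp: b_def bij_betw_def)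
    show "L \<subseteq> b ` {..<d}"
    proof
      fix l assume "l \<in> L"
      then obtain i where "i < m" "l = g i" using g by (auto simp: bij_betw_def)
      then show "l \<in> b ` {..<d}" using assms(3,4) by (intro image_eqI[of _ _ i]) (auto simp: b_def)
    qed
  qed
  moreover have "\<exists>i'<d. i' \<noteq> i \<and> b i' = b i" if "i < d" "i \<noteq> m - 1" for i
  proof (cases "i < m")
    case True
    then show ?thesis using that assms(3,4) by (intro exI[of _ "i + m"]) (auto simp: b_def)
  next
    case False
    then have "(i - m) mod m = i mod m" by (simp add: le_mod_geq)
    then show ?thesis using False that assms(3) by (intro exI[of _ "i - m"]) (auto simp: b_def)
  qed
  ultimately show ?thesis using that by blast
qed

lemma ex_syndrome_numbering:
  obtains e where "bij_betw e (Pow {..<h::nat}) {1..2 ^ h :: nat}"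
  using ex_bij_betw_finite_nat[of "Pow {..<h}"] finite_same_card_bij[of "Pow {..<h}" "{1..2 ^ h :: nat}"]
  by (auto simp: card_Pow)

text \<open>
  The syndrome is a proper colouring because no direction has the zero label, and a vertex sees every
  syndrome but its own because all nonzero labels occur.
\<close>

lemma silver_nonzero_labels:
  assumes I: "I \<in> parity_classes d" and h: "h \<ge> 1" and m: "m = 2 ^ h - 1"
    and d: "d = 2 * m - 1 \<or> d = 2 * m"
  shows "\<exists>c. defensive_silver_colouring (hypercube d) I 2 (2 ^ h) c"
proof -
  have "m \<ge> 1" using h m one_less_power[of "2::nat" h] by simp
  moreover have "card (Pow {..<h} - {{}}) = m" by (simp add: m card_Pow)
  ultimately obtain b p where b: "b ` {..<d} = Pow {..<h} - {{}}"
    and twin: "\<And>i. i < d \<Longrightarrow> i \<noteq> p \<Longrightarrow> \<exists>i'<d. i' \<noteq> i \<and> b i' = b i"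
    using ex_labelling[of "Pow {..<h} - {{}}" m d] d by (metis finite_Diff finite_Pow_iff finite_lessThan)
  obtain e where e: "bij_betw e (Pow {..<h}) {1..2 ^ h :: nat}" by (rule ex_syndrome_numbering)
  let ?s = "syndrome h d b"
  have bP: "b i \<in> Pow {..<h}" "b i \<noteq> {}" if "i < d" for i using b that by blast+
  have flip: "?s (flip i x) = sym_diff (?s x) (b i)" if "x \<in> carrier_vec d" "i < d" for x i
    using syndrome_flip that bP by blast
  have IV: "x \<in> carrier_vec d" if "x \<in> I" for x using parity_class_carrier[OF I that] .
  have "defensive_silver_colouring (hypercube d) I 2 (2 ^ h) (\<lambda>x. e (?s x))"
  proof (rule silver_criterion[OF I, where p = p])
    show "d \<ge> 1" using d \<open>m \<ge> 1\<close> by auto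
    show "(\<lambda>x. e (?s x)) ` carrier_vec d \<subseteq> {1..2 ^ h}"
      using bij_betw_imp_surj_on[OF e] syndrome_in_Pow by blast
    show "e (?s (flip i x)) \<noteq> e (?s x)" if "x \<in> carrier_vec d" "i < d" for x i
    proof -
      have "?s (flip i x) \<noteq> ?s x" using flip[OF that] bP[OF that(2)] by blast
      then show ?thesis
        using bij_betw_imp_inj_on[OF e] syndrome_in_Pow by (metis inj_on_eq_iff)
    qed
    show "\<exists>i<d. e (?s (flip i x)) = j" if x: "x \<in> I" and j: "j \<in> {1..2 ^ h}" "j \<noteq> e (?s x)" for x j
    proof -
      obtain l where l: "l \<in> Pow {..<h}" "j = e l" using bij_betw_imp_surj_on[OF e] j(1) by blast
      then have "l \<noteq> ?s x" using j(2) by metis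
      then have "sym_diff (?s x) l \<noteq> {}" by blast
      moreover have "sym_diff (?s x) l \<in> Pow {..<h}"
        using l(1) syndrome_in_Pow[of h d b x] by blast
      ultimately have "sym_diff (?s x) l \<in> Pow {..<h} - {{}}" by blast
      then obtain i where i: "i < d" "b i = sym_diff (?s x) l" using b by (metis imageE lessThan_iff)
      then have "?s (flip i x) = l" using flip[OF IV[OF x] i(1)] by blast
      then show ?thesis using i l by blast
    qed
    show "\<exists>i'<d. i' \<noteq> i \<and> e (?s (flip i' x)) = e (?s (flip i x))"
      if "x \<in> I" "i < d" "i \<noteq> p" for x i
      using twin[OF that(2,3)] flip[OF IV[OF that(1)]] that(2) by metis
  qed
  then show ?thesis by blast
qed

text \<open>
  With the zero label included, a vertex sees every syndrome, its own too. Hence the syndromes can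
  colour the complement of \<open>I\<close> only, and the extra colour on \<open>I\<close> makes the colouring proper.
\<close>

lemma silver_all_labels:
  assumes I: "I \<in> parity_classes d" and m: "m = 2 ^ h" and d: "d = 2 * m - 1 \<or> d = 2 * m"
  shows "\<exists>c. defensive_silver_colouring (hypercube d) I 2 (2 ^ h + 1) c"
proof -
  have "m \<ge> 1" using m by simp
  moreover have "card (Pow {..<h}) = m" by (simp add: m card_Pow)
  ultimately obtain b p where b: "b ` {..<d} = Pow {..<h}"
    and twin: "\<And>i. i < d \<Longrightarrow> i \<noteq> p \<Longrightarrow> \<exists>i'<d. i' \<noteq> i \<and> b i' = b i"
    using ex_labelling[of "Pow {..<h}" m d] d by (metis finite_Pow_iff finite_lessThan)
  obtain e where e: "bij_betw e (Pow {..<h}) {1..2 ^ h :: nat}" by (rule ex_syndrome_numbering)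
  let ?s = "syndrome h d b"
  define c where "c x = (if x \<in> I then 2 ^ h + 1 else e (?s x))" for x
  have bP: "b i \<in> Pow {..<h}" if "i < d" for i using b that by blast
  have flip: "?s (flip i x) = sym_diff (?s x) (b i)" if "x \<in> carrier_vec d" "i < d" for x i
    using syndrome_flip that bP by blast
  have IV: "x \<in> carrier_vec d" if "x \<in> I" for x using parity_class_carrier[OF I that] .
  have es: "e (?s x) \<in> {1..2 ^ h}" for x
    using bij_betw_imp_surj_on[OF e] syndrome_in_Pow by blast
  have c_flip: "c (flip i x) = e (?s (flip i x))" if "x \<in> I" "i < d" for x i
    using parity_class_flip[OF I IV[OF that(1)] that(2)] that(1) by (simp add: c_def)
  have "defensive_silver_colouring (hypercube d) I 2 (2 ^ h + 1) c"
  proof (rule silver_criterion[OF I, where p = p])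
    show "d \<ge> 1" using d \<open>m \<ge> 1\<close> by auto
    show "c ` carrier_vec d \<subseteq> {1..2 ^ h + 1}"
      using es by (fastforce simp: c_def)
    show "c (flip i x) \<noteq> c x" if "x \<in> carrier_vec d" "i < d" for x i
      using parity_class_flip[OF I that] es[of x] es[of "flip i x"] by (auto simp: c_def)
    show "\<exists>i<d. c (flip i x) = j" if x: "x \<in> I" and j: "j \<in> {1..2 ^ h + 1}" "j \<noteq> c x" for x j
    proof -
      have "j \<in> {1..2 ^ h}" using x j by (auto simp: c_def)
      then obtain l where l: "l \<in> Pow {..<h}" "j = e l" using bij_betw_imp_surj_on[OF e] by blast
      then have "sym_diff (?s x) l \<in> Pow {..<h}" using syndrome_in_Pow[of h d b x] by blast
      then obtain i where i: "i < d" "b i = sym_diff (?s x) l" using b by (metis imageE lessThan_iff)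
      then have "?s (flip i x) = l" using flip[OF IV[OF x] i(1)] by blast
      then show ?thesis using i l c_flip[OF x i(1)] by metis
    qed
    show "\<exists>i'<d. i' \<noteq> i \<and> c (flip i' x) = c (flip i x)"
      if "x \<in> I" "i < d" "i \<noteq> p" for x i
      using twin[OF that(2,3)] flip[OF IV[OF that(1)]] c_flip[OF that(1)] that(2) by metis
  qed
  then show ?thesis by blast
qed

section \<open>The values of sigma\<close>

lemma sigma_eqI:
  assumes "I \<in> parity_classes d" "d \<ge> 1" "d < 2 * r - 1"
    and "\<exists>c. defensive_silver_colouring (hypercube d) I 2 r c"
  shows "sigma 2 (hypercube d) I = r"
  unfolding sigma_def
proof (rule Max_eqI)
  show "finite {q. \<exists>c. defensive_silver_colouring (hypercube d) I 2 q c}"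
    by (rule finite_silver_numbers) (simp add: finite_carrier_vec_bit)
  show "s \<le> r" if "s \<in> {q. \<exists>c. defensive_silver_colouring (hypercube d) I 2 q c}" for s
    using that silver_upper_bound[OF assms(1,2)] assms(3) by force
qed (use assms(4) in simp)

theorem theorem3p8:
  fixes h q :: nat
  assumes "h \<ge> 1" and "q = 2 ^ h"
  shows "(\<forall>I \<in> parity_classes (2 * q - 3). sigma 2 (hypercube (2 * q - 3)) I = q) \<and>
         (\<forall>I \<in> parity_classes (2 * q - 2). sigma 2 (hypercube (2 * q - 2)) I = q) \<and>
         (\<forall>I \<in> parity_classes (2 * q - 1). sigma 2 (hypercube (2 * q - 1)) I = q + 1) \<and>
         (\<forall>I \<in> parity_classes (2 * q). sigma 2 (hypercube (2 * q)) I = q + 1)"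
proof -
  have q: "q \<ge> 2" using assms self_le_power[of "2::nat" h] by simp
  have low: "sigma 2 (hypercube d) I = q"
    if "I \<in> parity_classes d" "d = 2 * q - 3 \<or> d = 2 * q - 2" for I d
  proof (rule sigma_eqI[OF that(1)])
    show "\<exists>c. defensive_silver_colouring (hypercube d) I 2 q c"
      using silver_nonzero_labels[OF that(1) assms(1), of "q - 1"] that(2) q assms(2) by force
  qed (use that(2) q in auto)
  have high: "sigma 2 (hypercube d) I = q + 1"
    if "I \<in> parity_classes d" "d = 2 * q - 1 \<or> d = 2 * q" for I d
  proof (rule sigma_eqI[OF that(1)])
    show "\<exists>c. defensive_silver_colouring (hypercube d) I 2 (q + 1) c"
      using silver_all_labels[OF that(1) assms(2)] that(2) assms(2) by simp
  qed (use that(2) q in auto)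
  show ?thesis using low high by blast
qed

end
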